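(* Let $r\ge 2$ and let $1\le k_1<k_2<\cdots<k_s$ be fixed integers with $k_s=2^{r-1}$. Let $P(x)$ be the characteristic polynomial of the minimal homogeneous linear recurrence with integer coefficients satisfied by the sequence $\{S_n\}_{n\in\mathbb{N}}$, where $$S_n=\sum_{j=0}^n(-1)^{\binom{j}{k_1}+\cdots+\binom{j}{k_s}}\binom{n}{j}.$$ Then $$P(x)=\Phi_{2^r}(x-1)=2+\sum_{m=1}^{2^{r-1}}(-1)^m\binom{2^{r-1}}{m}x^m.$$ In particular, $\deg P=2^{r-1}=2^{\lfloor\log_2(k_s)\rfloor}$.
   Context: $\mathbb{N}=\{1,2,3,\dots\}$. $S_n$ is the exponential sum of the symmetric Boolean function $\sigma_{n,k_1}+\cdots+\sigma_{n,k_s}$, $\sigma_{n,k}$ being the elementary symmetric polynomial of degree $k$ in $n$ variables over $\mathbb{F}_2$. $\Phi_m$ is the $m$-th cyclotomic polynomial. A homogeneous linear recurrence $x_n=\sum_{i=1}^D a_ix_{n-i}$ with $a_i\in\mathbb{Z}$ has characteristic polynomial $x^D-\sum_{i=1}^D a_ix^{D-i}$; "minimal" means of least order. *)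

theory Defs
  imports
    "HOL-Analysis.Analysis"
    "HOL-Computational_Algebra.Computational_Algebra"
    "HOL-Library.FuncSet"
    "HOL-Library.Z2"
begin

definition elem_sym :: "nat \<Rightarrow> nat \<Rightarrow> (nat \<Rightarrow> bit) \<Rightarrow> bit" where
  "elem_sym n k x = (\<Sum>A | A \<subseteq> {1..n} \<and> card A = k. \<Prod>i\<in>A. x i)"

text \<open>The points of the \<open>n\<close>-dimensional vector space over the field with two elements
  are the extensional functions on \<open>{1..n}\<close> with values in \<^typ>\<open>bit\<close>.\<close>

definition exp_sum :: "nat \<Rightarrow> ((nat \<Rightarrow> bit) \<Rightarrow> bit) \<Rightarrow> int" where
  "exp_sum n f = (\<Sum>x \<in> {1..n} \<rightarrow>\<^sub>E UNIV. (-1) ^ (of_bit (f x) :: nat))"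

definition sym_exp_sum :: "nat \<Rightarrow> (nat \<Rightarrow> nat) \<Rightarrow> nat \<Rightarrow> int" where
  "sym_exp_sum s k n = exp_sum n (\<lambda>x. \<Sum>i=1..s. elem_sym n (k i) x)"

text \<open>Sequences are indexed by the positive integers: the value at \<open>0\<close> is ignored, so a
  recurrence of order \<open>D\<close> is required to hold from index \<open>D + 1\<close> on. Only the coefficients
  \<open>a 1, \<dots>, a D\<close> matter.\<close>

definition satisfies_recurrence :: "nat \<Rightarrow> (nat \<Rightarrow> int) \<Rightarrow> (nat \<Rightarrow> int) \<Rightarrow> bool" where
  "satisfies_recurrence D a x \<longleftrightarrow> (\<forall>n>D. x n = (\<Sum>i=1..D. a i * x (n - i)))"

definition recurrence_char_poly :: "nat \<Rightarrow> (nat \<Rightarrow> int) \<Rightarrow> int poly" where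
  "recurrence_char_poly D a = monom 1 D - (\<Sum>i=1..D. monom (a i) (D - i))"

definition minimal_recurrence :: "nat \<Rightarrow> (nat \<Rightarrow> int) \<Rightarrow> (nat \<Rightarrow> int) \<Rightarrow> bool" where
  "minimal_recurrence D a x \<longleftrightarrow> satisfies_recurrence D a x \<and>
     (\<forall>D' a'. satisfies_recurrence D' a' x \<longrightarrow> D \<le> D')"

definition is_minimal_char_poly :: "int poly \<Rightarrow> (nat \<Rightarrow> int) \<Rightarrow> bool" where
  "is_minimal_char_poly P x \<longleftrightarrow>
     (\<exists>D a. minimal_recurrence D a x \<and> P = recurrence_char_poly D a)"

definition primitive_roots_of_unity :: "nat \<Rightarrow> complex set" where
  "primitive_roots_of_unity m = {z. z ^ m = 1 \<and> (\<forall>d. 0 < d \<and> d < m \<longrightarrow> z ^ d \<noteq> 1)}"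

definition cyclotomic_poly :: "nat \<Rightarrow> complex poly" where
  "cyclotomic_poly m = (\<Prod>z\<in>primitive_roots_of_unity m. [:- z, 1:])"

end

theory Submission
  imports Defs
begin

text \<open>Write \<open>N = 2 ^ (r - 1)\<close> and let \<open>g j\<close> be the sign attached to \<open>j\<close>, so that \<open>S\<close> is the binomial
  transform of \<open>g\<close>. Since \<open>N choose i\<close> is even for \<open>0 < i < N\<close>, Vandermonde's identity
  gives \<open>g (j + N) = - g j\<close>. The binomial transform turns the shift minus one on \<open>S\<close> into the shift
  on \<open>g\<close>, so \<open>(X - 1) ^ N + 1\<close>, with \<open>X\<close> acting as the shift, annihilates \<open>S\<close> from index \<open>0\<close> on.
  This polynomial is Eisenstein at \<open>2\<close>, hence irreducible. An annihilator of smaller degree from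
  index \<open>1\<close> on would therefore force \<open>S n = 0\<close> for all \<open>n \<ge> 1\<close>, and the recurrence at index \<open>0\<close>
  would then read \<open>2 * S 0 = 0\<close>, whereas \<open>S 0 = 1\<close>.\<close>

section \<open>Divisibility of binomial coefficients and Eisenstein's criterion\<close>

text \<open>Otherwise \<open>p ^ e\<close> is coprime to the binomial coefficient, and
  \<open>m * (p ^ e choose m) = p ^ e * (p ^ e - 1 choose (m - 1))\<close> forces
  \<open>p ^ e\<close> to divide \<open>m\<close>.\<close>

lemma prime_power_dvd_choose:
  assumes "prime (p::nat)" "0 < m" "m < p ^ e"
  shows "p dvd (p ^ e choose m)"
proof (rule ccontr)
  assume "\<not> p dvd (p ^ e choose m)"
  hence "coprime (p ^ e) (p ^ e choose m)"
    using assms(1) by (simp add: prime_imp_coprime)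
  moreover have "p ^ e dvd m * (p ^ e choose m)"
    using times_binomial_minus1_eq[of m "p ^ e"] assms(2) by simp
  ultimately have "p ^ e dvd m"
    using coprime_dvd_mult_left_iff by blast
  with assms(2,3) show False
    by (auto dest: dvd_imp_le)
qed

text \<open>In the \<open>i\<close>-th coefficient of \<open>A * B\<close>, every term except
  \<open>coeff A i * coeff B 0\<close> contains a lower coefficient of \<open>A\<close>, so
  induction on \<open>i\<close> applies.\<close>

lemma dvd_low_coeffs_of_mult:
  fixes A B :: "'a::idom poly"
  assumes p: "prime_elem p" and "\<not> p dvd coeff B 0"
    and low: "\<And>i. i < n \<Longrightarrow> p dvd coeff (A * B) i"
  shows "i < n \<Longrightarrow> p dvd coeff A i"
proof (induction i rule: less_induct)
  case (less i)
  have "coeff (A * B) i = (\<Sum>j<i. coeff A j * coeff B (i - j)) + coeff A i * coeff B 0"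
    by (simp add: coeff_mult lessThan_Suc_atMost[symmetric])
  moreover have "p dvd (\<Sum>j<i. coeff A j * coeff B (i - j))"
    using less by (intro dvd_sum dvd_mult2) auto
  ultimately have "p dvd coeff A i * coeff B 0"
    using low[OF less.prems] by (simp add: dvd_add_right_iff)
  thus ?case
    using assms(2) prime_elem_dvd_mult_iff[OF p] by blast
qed

text \<open>Some factor, say \<open>B\<close>, has a constant coefficient not divisible by
  \<open>p\<close>. Then \<open>p\<close> divides all coefficients of the cofactor \<open>A\<close>
  below \<open>degree P\<close>, so \<open>degree A < degree P\<close> would make \<open>p\<close>
  divide the leading coefficient 1. Hence \<open>B\<close> is constant, and a unit because
  \<open>P\<close> is monic.\<close>

lemma eisenstein_monic:
  fixes P :: "'a::idom poly"
  assumes p: "prime_elem p" and monic: "lead_coeff P = 1" and deg: "degree P > 0"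
    and low: "\<And>i. i < degree P \<Longrightarrow> p dvd coeff P i" and "\<not> p ^ 2 dvd coeff P 0"
  shows "irreducible P"
proof (rule irreducibleI)
  show "P \<noteq> 0" "\<not> P dvd 1"
    using deg by (auto simp: is_unit_poly_iff)
next
  have unit: "B dvd 1" if P: "P = A * B" and B: "\<not> p dvd coeff B 0" for A B
  proof -
    have nz: "A \<noteq> 0" "B \<noteq> 0"
      using P deg by auto
    have A: "p dvd coeff A i" if "i < degree P" for i
      using dvd_low_coeffs_of_mult[OF p B _ that] low P by metis
    have "degree A \<ge> degree P"
    proof (rule ccontr)
      assume "\<not> degree A \<ge> degree P"
      hence "p dvd lead_coeff A"
        by (intro A) simp
      hence "p dvd lead_coeff P"
        using P by (simp add: lead_coeff_mult)
      thus False
        using monic p by (auto simp: prime_elem_def)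
    qed
    hence "degree B = 0"
      using P nz by (simp add: degree_mult_eq)
    then obtain b where b: "B = [:b:]"
      by (rule degree_eq_zeroE)
    with P monic have "b dvd 1"
      by (metis dvdI lead_coeff_mult degree_pCons_0 coeff_pCons_0 mult.commute)
    thus ?thesis
      using b by (simp add: is_unit_const_poly_iff)
  qed
  fix A B assume P: "P = A * B"
  have "\<not> (p dvd coeff A 0 \<and> p dvd coeff B 0)"
    using assms(5) P by (auto simp: coeff_mult power2_eq_square mult_dvd_mono)
  thus "A dvd 1 \<or> B dvd 1"
    using unit[OF P] unit[of B A] P by (auto simp: mult.commute)
qed

section \<open>Polynomials in the shift operator\<close>

text \<open>This is \<open>p\<close> evaluated at the shift operator and applied to
  \<open>u\<close>; it makes sequences a module over the polynomial ring and turns recurrences into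
  annihilators.\<close>

definition shift_apply :: "'a::comm_ring_1 poly \<Rightarrow> (nat \<Rightarrow> 'a) \<Rightarrow> nat \<Rightarrow> 'a" where
  "shift_apply p u n = (\<Sum>i\<le>degree p. coeff p i * u (n + i))"

lemma shift_apply_0 [simp]: "shift_apply 0 u n = 0"
  by (simp add: shift_apply_def)

lemma shift_apply_pCons [simp]:
  "shift_apply (pCons a p) u n = a * u n + shift_apply p u (Suc n)"
  by (cases "p = 0") (simp_all add: shift_apply_def sum.atMost_Suc_shift degree_pCons_eq del: sum.atMost_Suc)

lemma shift_apply_1 [simp]: "shift_apply 1 u n = u n"
  by (simp add: one_pCons)

lemma shift_apply_eq_0:
  "(\<And>i. u (n + i) = 0) \<Longrightarrow> shift_apply p u n = 0"
  by (simp add: shift_apply_def)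

lemma shift_apply_add [simp]:
  "shift_apply (p + q) u n = shift_apply p u n + shift_apply q u n"
  by (induction p q arbitrary: n rule: poly_induct2) (simp_all add: algebra_simps)

lemma shift_apply_smult [simp]: "shift_apply (smult c p) u n = c * shift_apply p u n"
  by (induction p arbitrary: n) (simp_all add: algebra_simps)

lemma shift_apply_diff [simp]:
  "shift_apply (p - q) u n = shift_apply p u n - shift_apply q u n"
  by (induction p q arbitrary: n rule: poly_induct2) (simp_all add: algebra_simps)

lemma shift_apply_mult: "shift_apply (p * q) u n = shift_apply p (shift_apply q u) n"
  by (induction p arbitrary: n) simp_all

lemma shift_apply_sum: "shift_apply (\<Sum>i\<in>A. f i) u n = (\<Sum>i\<in>A. shift_apply (f i) u n)"
  by (induction A rule: infinite_finite_induct) simp_all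

lemma shift_apply_monom [simp]: "shift_apply (monom c m) u n = c * u (n + m)"
  by (induction m arbitrary: n) (simp_all add: monom_0 monom_Suc)

section \<open>The binomial transform\<close>

definition binomial_transform :: "(nat \<Rightarrow> 'a::comm_ring_1) \<Rightarrow> nat \<Rightarrow> 'a" where
  "binomial_transform g n = (\<Sum>j=0..n. g j * of_nat (n choose j))"

text \<open>Pascal's rule, summed. It says that shift minus identity on the transform corresponds to
  the shift on \<open>g\<close>.\<close>

lemma binomial_transform_Suc:
  "binomial_transform g (Suc n) = binomial_transform g n + binomial_transform (\<lambda>j. g (Suc j)) n"
proof -
  have "binomial_transform g (Suc n) =
      g 0 + (\<Sum>j\<le>n. g (Suc j) * of_nat (n choose Suc j)) + (\<Sum>j\<le>n. g (Suc j) * of_nat (n choose j))"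
    unfolding binomial_transform_def atLeast0AtMost
    by (subst sum.atMost_Suc_shift) (simp add: sum.distrib algebra_simps)
  \<comment> \<open>The range up to \<open>Suc n\<close> has one term too many; it vanishes since
    \<open>n choose Suc n = 0\<close>.\<close>
  also have "g 0 + (\<Sum>j\<le>n. g (Suc j) * of_nat (n choose Suc j)) = (\<Sum>j\<le>Suc n. g j * of_nat (n choose j))"
    by (subst sum.atMost_Suc_shift) simp
  finally show ?thesis
    by (simp add: binomial_transform_def atLeast0AtMost binomial_eq_0)
qed

lemma shift_apply_power_binomial_transform:
  "shift_apply ([:-1, 1:] ^ m) (binomial_transform g) n = binomial_transform (\<lambda>j. g (j + m)) n"
proof (induction m arbitrary: n)
  case (Suc m)
  have "shift_apply ([:-1, 1:] ^ m) (binomial_transform g) = binomial_transform (\<lambda>j. g (j + m))"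
    using Suc.IH by blast
  thus ?case
    unfolding power_Suc by (simp add: shift_apply_mult binomial_transform_Suc del: mult_pCons_left)
qed simp

lemma shift_apply_antiperiodic:
  assumes "\<And>j. g (j + m) = - g j"
  shows "shift_apply ([:-1, 1:] ^ m + 1) (binomial_transform g) n = 0"
  using assms
  by (simp add: shift_apply_power_binomial_transform) (simp add: binomial_transform_def sum_negf)

section \<open>Annihilators, recurrences and minimality\<close>

lemma no_annihilator_of_smaller_degree:
  fixes u :: "nat \<Rightarrow> int"
  assumes irred: "irreducible P"
    and ann: "\<And>n. shift_apply P u n = 0"
    and nz: "coeff P 0 * u 0 \<noteq> 0"
    and R: "\<And>n. n \<ge> 1 \<Longrightarrow> shift_apply R u n = 0" and deg: "degree R < degree P"
  shows "R = 0"
proof (rule ccontr)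
  assume "R \<noteq> 0"
  \<comment> \<open>An annihilator \<open>G\<close> of least degree divides a constant multiple of \<open>P\<close>, by pseudo-division;
    as \<open>P\<close> is prime, \<open>G\<close> is constant.\<close>
  define J where "J = (\<lambda>G. G \<noteq> 0 \<and> (\<forall>n\<ge>1. shift_apply G u n = 0))"
  have "J R"
    using R \<open>R \<noteq> 0\<close> by (simp add: J_def)
  then obtain G where G: "J G" and min: "\<And>H. J H \<Longrightarrow> degree G \<le> degree H"
    using ex_has_least_nat[of J R degree] by blast
  hence "G \<noteq> 0" and G0: "\<And>n. n \<ge> 1 \<Longrightarrow> shift_apply G u n = 0"
    by (auto simp: J_def)
  obtain c H where c: "c \<noteq> 0" "smult c P = G * H + pseudo_mod P G"
    using pseudo_mod(1)[OF \<open>G \<noteq> 0\<close>] by metis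
  have "shift_apply (pseudo_mod P G) u n = 0" if "n \<ge> 1" for n
  proof -
    have "pseudo_mod P G = smult c P - H * G"
      using c(2) by (simp add: mult.commute)
    moreover have "shift_apply (H * G) u n = 0"
      unfolding shift_apply_mult using that by (intro shift_apply_eq_0[where u = "shift_apply G u"] G0) simp
    ultimately show ?thesis
      by (simp add: ann)
  qed
  \<comment> \<open>A nonzero remainder would be an annihilator of degree below that of
    \<open>G\<close>.\<close>
  hence "pseudo_mod P G = 0"
    using pseudo_mod(2)[OF \<open>G \<noteq> 0\<close>, of P] min[of "pseudo_mod P G"] unfolding J_def by fastforce
  with c have eq: "smult c P = G * H"
    by simp
  have "P dvd G * H"
    by (metis eq dvd_refl dvd_smult)
  moreover have "\<not> P dvd G"
    using dvd_imp_degree_le[of P G] min[OF \<open>J R\<close>] deg \<open>G \<noteq> 0\<close> by auto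
  ultimately have "P dvd H"
    using irreducible_imp_prime_poly[OF irred] prime_elem_dvd_multD by blast
  then obtain K where "H = P * K"
    by blast
  with eq have "P * [:c:] = P * (G * K)"
    by (simp add: ac_simps)
  hence "G * K = [:c:]"
    using irred by (metis irreducible_def mult_left_cancel)
  hence "degree G = 0"
    using c(1) \<open>G \<noteq> 0\<close> by (metis add_is_0 degree_mult_eq degree_pCons_0 mult_zero_right pCons_eq_0_iff)
  then obtain g where g: "G = [:g:]"
    by (rule degree_eq_zeroE)
  \<comment> \<open>A nonzero constant annihilates \<open>u\<close> from index 1 on only if
    \<open>u\<close> vanishes there, so at index 0 only the constant term of \<open>P\<close>
    contributes.\<close>
  have "u n = 0" if "n \<ge> 1" for n
    using G0[OF that] g \<open>G \<noteq> 0\<close> by simp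
  hence "shift_apply P u 0 = coeff P 0 * u 0"
    by (simp add: shift_apply_def sum.atMost_shift)
  with ann nz show False
    by simp
qed

lemma coeff_recurrence_char_poly:
  "coeff (recurrence_char_poly D a) j =
     (if j = D then 1 else if j < D then - a (D - j) else 0)"
proof -
  have *: "(\<Sum>i=1..D. coeff (monom (a i) (D - i)) j) = (if j < D then a (D - j) else 0)"
  proof (cases "j < D")
    case True
    have "(\<Sum>i=1..D. coeff (monom (a i) (D - i)) j) = (\<Sum>i=1..D. if i = D - j then a i else 0)"
      using True by (intro sum.cong) auto
    thus ?thesis
      using True by (simp add: sum.delta)
  qed (auto intro!: sum.neutral)
  show ?thesis
    by (simp only: recurrence_char_poly_def coeff_diff coeff_sum *) simp
qed

lemma
  shows degree_recurrence_char_poly [simp]: "degree (recurrence_char_poly D a) = D"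
    and lead_coeff_recurrence_char_poly: "lead_coeff (recurrence_char_poly D a) = 1"
proof -
  show *: "degree (recurrence_char_poly D a) = D"
    by (rule antisym) (auto intro!: degree_le le_degree simp: coeff_recurrence_char_poly)
  show "lead_coeff (recurrence_char_poly D a) = 1"
    by (simp add: * coeff_recurrence_char_poly)
qed

lemma monic_eq_recurrence_char_poly:
  assumes "lead_coeff P = 1"
  shows "P = recurrence_char_poly (degree P) (\<lambda>i. - coeff P (degree P - i))"
  by (rule poly_eqI) (use assms in \<open>auto simp: coeff_recurrence_char_poly coeff_eq_0\<close>)

text \<open>The recurrence at index \<open>n + D\<close> is annihilation at index \<open>n\<close>,
  so the range \<open>n > D\<close> becomes \<open>n \<ge> 1\<close>.\<close>

lemma satisfies_recurrence_iff_shift_apply: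
  "satisfies_recurrence D a x \<longleftrightarrow> (\<forall>n\<ge>1. shift_apply (recurrence_char_poly D a) x n = 0)"
proof -
  have *: "shift_apply (recurrence_char_poly D a) x n = x (n + D) - (\<Sum>i=1..D. a i * x (n + D - i))" for n
    by (auto simp: recurrence_char_poly_def shift_apply_sum intro!: sum.cong)
  show ?thesis
    unfolding satisfies_recurrence_def *
  proof safe
    fix n assume "\<forall>n\<ge>1. x (n + D) - (\<Sum>i=1..D. a i * x (n + D - i)) = 0" and "n > D"
    thus "x n = (\<Sum>i=1..D. a i * x (n - i))"
      by (auto dest!: spec[of _ "n - D"])
  qed auto
qed

text \<open>Two monic annihilators of the same positive degree differ by an annihilator of smaller
  degree, which is 0 by \<open>least\<close>; so a minimal recurrence is unique.\<close>

lemma is_minimal_char_poly_iff: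
  assumes monic: "lead_coeff P = 1"
    and ann: "\<And>n. n \<ge> 1 \<Longrightarrow> shift_apply P x n = 0"
    and least: "\<And>R. degree R < degree P \<Longrightarrow> (\<And>n. n \<ge> 1 \<Longrightarrow> shift_apply R x n = 0) \<Longrightarrow> R = 0"
  shows "is_minimal_char_poly Q x \<longleftrightarrow> Q = P"
proof -
  define a where "a = (\<lambda>i. - coeff P (degree P - i))"
  have P: "P = recurrence_char_poly (degree P) a"
    unfolding a_def using monic by (rule monic_eq_recurrence_char_poly)
  have sat: "satisfies_recurrence (degree P) a x"
    using ann P by (simp add: satisfies_recurrence_iff_shift_apply)
  have le: "degree P \<le> D" if "satisfies_recurrence D b x" for D b
  proof (rule ccontr)
    assume "\<not> degree P \<le> D"
    hence "recurrence_char_poly D b = 0"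
      using that by (intro least) (auto simp: satisfies_recurrence_iff_shift_apply)
    thus False
      using lead_coeff_recurrence_char_poly[of D b] by simp
  qed
  show ?thesis
  proof
    assume "is_minimal_char_poly Q x"
    then obtain D b where D: "minimal_recurrence D b x" and Q: "Q = recurrence_char_poly D b"
      by (auto simp: is_minimal_char_poly_def)
    have "D = degree P"
      using D le sat by (intro antisym) (auto simp: minimal_recurrence_def)
    have "Q - P = 0"
    \<comment> \<open>In degree 0 there is no smaller degree to which \<open>least\<close> could
      apply, but then both polynomials are 1.\<close>
    proof (cases "degree P = 0")
      case True
      thus ?thesis
        using \<open>D = degree P\<close> Q P by (simp add: recurrence_char_poly_def)
    next
      case False
      have "coeff (Q - P) i = 0" if "i \<ge> degree P" for i
        using that monic \<open>D = degree P\<close>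
        by (cases "i = degree P") (auto simp: Q coeff_recurrence_char_poly coeff_eq_0)
      hence "degree (Q - P) < degree P"
        using False by (metis leading_coeff_0_iff degree_0 gr0I not_le)
      thus ?thesis
        using D ann by (intro least) (auto simp: Q minimal_recurrence_def satisfies_recurrence_iff_shift_apply)
    qed
    thus "Q = P" by simp
  next
    assume "Q = P"
    thus "is_minimal_char_poly Q x"
      unfolding is_minimal_char_poly_def minimal_recurrence_def using P sat le by blast
  qed
qed

section \<open>The exponential sum as a binomial transform\<close>

lemma of_nat_bit: "(of_nat m :: bit) = of_bool (odd m)"
  by (induction m) auto

text \<open>The monomial of \<open>A\<close> is 1 exactly when \<open>A\<close> lies in the support
  of \<open>x\<close>, so the value counts the \<open>k\<close>-subsets of the support modulo
  2.\<close>

lemma elem_sym_eq_choose: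
  "elem_sym n k x = of_nat (card {i\<in>{1..n}. x i = 1} choose k)"
proof -
  let ?T = "{i\<in>{1..n}. x i = 1}"
  have "elem_sym n k x = (\<Sum>A | A \<subseteq> {1..n} \<and> card A = k. of_bool (A \<subseteq> ?T))"
    unfolding elem_sym_def
  proof (intro sum.cong refl)
    fix A assume "A \<in> {A. A \<subseteq> {1..n} \<and> card A = k}"
    hence A: "A \<subseteq> {1..n}" "finite A"
      using finite_subset by auto
    show "(\<Prod>i\<in>A. x i) = of_bool (A \<subseteq> ?T)"
    proof (cases "A \<subseteq> ?T")
      case False
      then obtain i where "i \<in> A" "i \<notin> ?T"
        by blast
      hence "i \<in> A" "x i = 0"
        using A by auto
      thus ?thesis
        using A False by (auto simp: prod_zero)
    qed (auto intro!: prod.neutral)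
  qed
  also have "\<dots> = of_nat (card ({A. A \<subseteq> {1..n} \<and> card A = k} \<inter> {A. A \<subseteq> ?T}))"
    by (rule sum_of_bool_eq) (rule finite_subset[of _ "Pow {1..n}"], auto)
  also have "{A. A \<subseteq> {1..n} \<and> card A = k} \<inter> {A. A \<subseteq> ?T} = {A. A \<subseteq> ?T \<and> card A = k}"
    by auto
  finally show ?thesis
    by (simp add: n_subsets)
qed

lemma sum_subsets_card:
  fixes g :: "nat \<Rightarrow> 'a::comm_semiring_1"
  assumes "finite S"
  shows "(\<Sum>T\<in>Pow S. g (card T)) = (\<Sum>j=0..card S. g j * of_nat (card S choose j))"
proof -
  have "(\<Sum>T\<in>Pow S. g (card T)) = (\<Sum>j\<in>{0..card S}. \<Sum>T | T \<in> Pow S \<and> card T = j. g (card T))"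
    using assms by (subst sum.group) (auto simp: card_mono)
  also have "\<dots> = (\<Sum>j\<in>{0..card S}. g j * of_nat (card S choose j))"
    using assms by (intro sum.cong) (auto simp: n_subsets[symmetric] mult.commute)
  finally show ?thesis .
qed

lemma bij_betw_support:
  "bij_betw (\<lambda>x. {i\<in>S. x i = (1::bit)}) (S \<rightarrow>\<^sub>E UNIV) (Pow S)"
proof (rule bij_betw_byWitness[where f' = "\<lambda>T. restrict (\<lambda>i. of_bool (i \<in> T)) S"])
  show "\<forall>x\<in>S \<rightarrow>\<^sub>E UNIV. restrict (\<lambda>i. of_bool (i \<in> {i\<in>S. x i = (1::bit)})) S = x"
    by (auto simp: fun_eq_iff PiE_def extensional_def)
qed auto

text \<open>The sign at a point depends only on the size \<open>j\<close> of its support, and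
  \<open>n choose j\<close> points have a support of that size.\<close>

lemma sym_exp_sum_eq_binomial_transform:
  "sym_exp_sum s k n = binomial_transform (\<lambda>j. (-1) ^ (\<Sum>i=1..s. j choose k i)) n"
proof -
  define g :: "nat \<Rightarrow> int" where "g = (\<lambda>j. (-1) ^ (\<Sum>i=1..s. j choose k i))"
  have sign: "(-1) ^ (of_bit (\<Sum>i=1..s. elem_sym n (k i) x) :: nat)
      = g (card {i\<in>{1..n}. x i = 1})" for x
  proof -
    let ?m = "\<Sum>i=1..s. card {i\<in>{1..n}. x i = 1} choose k i"
    have "(\<Sum>i=1..s. elem_sym n (k i) x) = of_nat ?m"
      by (simp add: elem_sym_eq_choose)
    also have "\<dots> = of_bool (odd ?m)"
      by (rule of_nat_bit)
    finally show ?thesis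
      unfolding g_def by (cases "odd ?m") (simp_all only: minus_one_power_iff, simp_all)
  qed
  have "sym_exp_sum s k n = (\<Sum>x\<in>{1..n} \<rightarrow>\<^sub>E UNIV. g (card {i\<in>{1..n}. x i = (1::bit)}))"
    by (simp only: sym_exp_sum_def exp_sum_def sign)
  also have "\<dots> = (\<Sum>T\<in>Pow {1..n}. g (card T))"
    by (rule sum.reindex_bij_betw[OF bij_betw_support])
  also have "\<dots> = binomial_transform g n"
    by (subst sum_subsets_card) (simp_all add: binomial_transform_def)
  finally show ?thesis
    by (simp add: g_def)
qed

section \<open>Parity of binomial coefficients under a shift by a power of two\<close>

text \<open>In Vandermonde's sum the factors \<open>2 ^ e choose i\<close> with
  \<open>0 < i < 2 ^ e\<close> are even. For \<open>k > 0\<close> this leaves the term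
  \<open>j choose k\<close> at \<open>i = 0\<close> and the term \<open>2 ^ e choose k\<close> at
  \<open>i = k\<close>, which is odd only for \<open>k = 2 ^ e\<close>.\<close>

lemma choose_add_power2_parity:
  assumes "k \<le> 2 ^ e"
  shows "odd (j + 2 ^ e choose k) \<longleftrightarrow> (odd (j choose k) \<noteq> (k = 2 ^ e))"
proof -
  have vander: "(j + 2 ^ e choose k) = (\<Sum>i\<le>k. (2 ^ e choose i) * (j choose (k - i)))"
    by (metis add.commute vandermonde)
  have even: "even (2 ^ e choose i)" if "0 < i" "i < 2 ^ e" for i
    using prime_power_dvd_choose[OF two_is_prime_nat that] .
  show ?thesis
  proof (cases "k = 0")
    case False
    then obtain k' where k: "k = Suc k'"
      by (cases k) auto
    have "even (\<Sum>i<k'. (2 ^ e choose Suc i) * (j choose (k - Suc i)))"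
      using assms k by (intro dvd_sum dvd_mult2 even) auto
    moreover have "(\<Sum>i\<le>k. (2 ^ e choose i) * (j choose (k - i))) =
        (j choose k) + (\<Sum>i<k'. (2 ^ e choose Suc i) * (j choose (k - Suc i))) + (2 ^ e choose k)"
      unfolding k by (subst sum.atMost_Suc_shift) (simp add: lessThan_Suc_atMost[symmetric])
    moreover have "odd (2 ^ e choose k) \<longleftrightarrow> k = 2 ^ e"
      using even[of k] False assms by (cases "k = 2 ^ e") auto
    ultimately show ?thesis
      unfolding vander by simp
  qed auto
qed

text \<open>Only the largest index \<open>k s\<close> equals \<open>2 ^ e\<close>, so exactly one
  summand changes parity.\<close>

lemma sum_choose_add_power2_parity:
  fixes k :: "nat \<Rightarrow> nat"
  assumes "strict_mono_on {1..s} k" "s \<ge> 1" "k s = 2 ^ e"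
  shows "odd (\<Sum>i=1..s. (j + 2 ^ e) choose k i) \<longleftrightarrow> even (\<Sum>i=1..s. j choose k i)"
proof -
  obtain t where s: "s = Suc t"
    using assms(2) by (cases s) auto
  have less: "k i < 2 ^ e" if "i \<in> {1..t}" for i
    using strict_mono_onD[OF assms(1), of i s] that s assms(3) by auto
  have "odd ((j + 2 ^ e) choose k i) \<longleftrightarrow> odd (j choose k i)" if "i \<in> {1..t}" for i
    using choose_add_power2_parity[of "k i" e j] less[OF that] by simp
  hence "{i\<in>{1..t}. odd ((j + 2 ^ e) choose k i)} = {i\<in>{1..t}. odd (j choose k i)}"
    by blast
  hence "even (\<Sum>i=1..t. (j + 2 ^ e) choose k i) \<longleftrightarrow> even (\<Sum>i=1..t. j choose k i)"
    by (simp only: even_sum_iff[OF finite_atLeastAtMost])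
  thus ?thesis
    using choose_add_power2_parity[of "k s" e j] assms(3) by (simp add: s)
qed

section \<open>The polynomial \<open>(X - 1) ^ N + 1\<close> and cyclotomic polynomials\<close>

lemma coeff_linear_power:
  "coeff ([:a, b:] ^ n) i = of_nat (n choose i) * b ^ i * a ^ (n - i)"
proof (cases "i \<le> n")
  case False
  hence "degree ([:a, b:] ^ n) < i"
    using degree_power_le[of "[:a, b:]" n] by (simp split: if_splits)
  thus ?thesis
    using False by (simp add: coeff_eq_0 binomial_eq_0)
qed (simp add: coeff_linear_poly_power)

text \<open>Evenness of \<open>N\<close> turns the sign \<open>(-1) ^ (N - i)\<close> into
  \<open>(-1) ^ i\<close> and makes the constant term \<open>1 + 1\<close>.\<close>

lemma poly_minus_one_power_plus_one:
  assumes "even N" "N > 0"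
  shows "[:-1, 1:] ^ N + 1 = [:2:] + (\<Sum>m=1..N. monom ((-1) ^ m * int (N choose m)) m)"
proof (rule poly_eqI)
  fix i
  have "(\<Sum>m=1..N. coeff (monom ((-1) ^ m * int (N choose m)) m) i) =
      (if i \<in> {1..N} then (-1) ^ i * int (N choose i) else 0)"
    by (simp add: sum.delta)
  moreover have "(-1 :: int) ^ (N - i) = (-1) ^ i" if "i \<le> N"
    using that assms(1) by (simp add: minus_one_power_iff)
  ultimately show "coeff ([:-1, 1:] ^ N + 1) i =
      coeff ([:2:] + (\<Sum>m=1..N. monom ((-1) ^ m * int (N choose m)) m)) i"
    using assms
    by (cases "i \<le> N") (auto simp: coeff_sum coeff_linear_power coeff_pCons coeff_1 binomial_eq_0 split: nat.split)
qed

lemma primitive_roots_of_unity_power2: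
  "primitive_roots_of_unity (2 ^ Suc e) = {z. z ^ 2 ^ e = -1}"
proof safe
  fix z assume z: "z \<in> primitive_roots_of_unity (2 ^ Suc e)"
  hence "(z ^ 2 ^ e)\<^sup>2 = 1" "z ^ 2 ^ e \<noteq> 1"
    by (auto simp: primitive_roots_of_unity_def power_mult[symmetric] mult.commute)
  thus "z ^ 2 ^ e = -1"
    by (simp add: power2_eq_1_iff)
next
  fix z :: complex assume z: "z ^ 2 ^ e = -1"
  have one: "z ^ 2 ^ Suc e = 1"
    using z by (simp add: power_mult mult.commute[of 2] power2_eq_square)
  have "z ^ d \<noteq> 1" if d: "0 < d" "d < 2 ^ Suc e" for d
  proof
    assume "z ^ d = 1"
    \<comment> \<open>By Bezout the order of \<open>z\<close> divides the gcd. This is a power of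
      two below \<open>2 ^ Suc e\<close>, hence divides \<open>2 ^ e\<close>, contradicting
      \<open>z ^ 2 ^ e = -1\<close>.\<close>
    obtain a b where ab: "a * d = b * 2 ^ Suc e + gcd d (2 ^ Suc e)"
      using bezout_nat[of d "2 ^ Suc e"] d by (metis mult.commute less_irrefl)
    have "z ^ (a * d) = z ^ (b * 2 ^ Suc e + gcd d (2 ^ Suc e))"
      using ab by simp
    hence g: "z ^ gcd d (2 ^ Suc e) = 1"
      using \<open>z ^ d = 1\<close> one by (metis mult.commute power_add power_mult power_one mult_1)
    obtain i where i: "i \<le> Suc e" "gcd d (2 ^ Suc e) = 2 ^ i"
      using divides_primepow_nat[OF two_is_prime_nat, of "gcd d (2 ^ Suc e)" "Suc e"] by auto
    have "2 ^ i \<le> d"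
      using i(2) d by (metis gcd_le1_nat less_irrefl)
    hence "i \<noteq> Suc e"
      using d by auto
    hence "(2::nat) ^ i dvd 2 ^ e"
      using i by (intro le_imp_power_dvd) simp
    hence "z ^ 2 ^ e = 1"
      using g i by (metis dvdE power_mult power_one)
    with z show False by simp
  qed
  thus "z \<in> primitive_roots_of_unity (2 ^ Suc e)"
    using one by (auto simp: primitive_roots_of_unity_def)
qed

text \<open>Both sides are monic with the same roots. The right side has no multiple root, since its
  derivative can vanish only at 0, which is not a root.\<close>

lemma cyclotomic_poly_power2: "cyclotomic_poly (2 ^ Suc e) = monom 1 (2 ^ e) + 1"
proof -
  let ?p = "monom 1 (2 ^ e) + 1 :: complex poly"
  have deg: "degree ?p = 2 ^ e"
    by (simp add: degree_add_eq_left degree_monom_eq)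
  have root: "poly ?p z = 0 \<longleftrightarrow> z ^ 2 ^ e = -1" for z
    by (simp add: poly_monom eq_neg_iff_add_eq_0)
  have "rsquarefree ?p"
    unfolding rsquarefree_roots root
    by (auto simp: pderiv_add pderiv_monom poly_monom power_0_left)
  from complex_poly_decompose_rsquarefree[OF this]
  have "smult (lead_coeff ?p) (cyclotomic_poly (2 ^ Suc e)) = ?p"
    by (simp only: cyclotomic_poly_def primitive_roots_of_unity_power2 root)
  moreover have "lead_coeff ?p = 1"
    unfolding deg by (simp add: coeff_1)
  ultimately show ?thesis
    by (simp only: smult_1_left)
qed

lemma map_poly_of_int_minus_one_power_plus_one:
  "map_poly of_int ([:-1, 1:] ^ 2 ^ e + 1) = pcompose (cyclotomic_poly (2 ^ Suc e)) [:-1, 1:]"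
proof -
  have "map_poly of_int ([:-1, 1:] ^ m + 1) = ([:-1, 1:] ^ m + 1 :: complex poly)" for m
    by (rule poly_eqI) (simp add: coeff_map_poly coeff_linear_power coeff_1)
  moreover have "pcompose (monom 1 m + 1) [:-1, 1:] = ([:-1, 1:] ^ m + 1 :: complex poly)" for m
    by (simp add: poly_eq_poly_eq_iff[symmetric] fun_eq_iff poly_pcompose poly_monom)
  ultimately show ?thesis
    by (simp only: cyclotomic_poly_power2)
qed

lemma
  assumes "N > 0"
  shows degree_minus_one_power_plus_one: "degree ([:-1, 1:] ^ N + 1 :: int poly) = N"
    and lead_coeff_minus_one_power_plus_one: "lead_coeff ([:-1, 1:] ^ N + 1 :: int poly) = 1"
proof -
  have *: "degree ([:-1, 1:] ^ N :: int poly) = N"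
    by (simp add: degree_power_eq)
  show deg: "degree ([:-1, 1:] ^ N + 1 :: int poly) = N"
    using assms by (subst degree_add_eq_left) (simp_all add: *)
  show "lead_coeff ([:-1, 1:] ^ N + 1 :: int poly) = 1"
    unfolding deg using assms by (simp add: coeff_linear_power coeff_1)
qed

text \<open>Since \<open>e > 0\<close>, the exponent \<open>2 ^ e\<close> is even and the constant
  coefficient is exactly 2; the coefficients strictly between the ends are even binomial
  coefficients up to sign.\<close>

lemma irreducible_minus_one_power2_plus_one:
  assumes "e > 0"
  shows "irreducible ([:-1, 1:] ^ 2 ^ e + 1 :: int poly)"
proof (rule eisenstein_monic[where p = 2])
  let ?P = "[:-1, 1:] ^ 2 ^ e + 1 :: int poly"
  have deg: "degree ?P = 2 ^ e"
    by (simp add: degree_minus_one_power_plus_one)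
  have 0: "coeff ?P 0 = 2"
    using assms by (simp add: coeff_linear_power)
  show "lead_coeff ?P = 1"
    by (rule lead_coeff_minus_one_power_plus_one) simp
  show "degree ?P > 0"
    by (simp add: deg)
  show "\<not> 2\<^sup>2 dvd coeff ?P 0"
    unfolding 0 by simp
  fix i assume i: "i < degree ?P"
  show "2 dvd coeff ?P i"
  proof (cases "i = 0")
    case False
    hence "even (2 ^ e choose i)"
      using prime_power_dvd_choose[OF two_is_prime_nat, of i e] i deg by simp
    thus ?thesis
      using False by (simp add: coeff_linear_power coeff_1)
  next
    case True
    thus ?thesis
      unfolding True 0 by simp
  qed
qed auto

section \<open>The minimal recurrence of the exponential sums\<close>

theorem mainTheorem7:
  fixes r s :: nat and k :: "nat \<Rightarrow> nat"
  assumes "r \<ge> 2"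
    and "s \<ge> 1"
    and "k 1 \<ge> 1"
    and "strict_mono_on {1..s} k"
    and "k s = 2 ^ (r - 1)"
  shows "(\<forall>n\<ge>1. sym_exp_sum s k n =
            (\<Sum>j=0..n. (-1) ^ (\<Sum>i=1..s. j choose k i) * int (n choose j))) \<and>
         (\<exists>!P. is_minimal_char_poly P (sym_exp_sum s k)) \<and>
         (\<forall>P. is_minimal_char_poly P (sym_exp_sum s k) \<longrightarrow>
            map_poly of_int P = pcompose (cyclotomic_poly (2 ^ r)) [:-1, 1:] \<and>
            P = [:2:] + (\<Sum>m=1..2 ^ (r - 1). monom ((-1) ^ m * int ((2 ^ (r - 1)) choose m)) m) \<and>
            degree P = 2 ^ (r - 1) \<and>
            degree P = 2 ^ nat \<lfloor>log 2 (real (k s))\<rfloor>)"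
proof -
  define e where "e = r - 1"
  have e: "e > 0" "r = Suc e"
    using assms(1) by (auto simp: e_def)
  define g :: "nat \<Rightarrow> int" where "g = (\<lambda>j. (-1) ^ (\<Sum>i=1..s. j choose k i))"
  define P :: "int poly" where "P = [:-1, 1:] ^ 2 ^ e + 1"
  have S: "sym_exp_sum s k = binomial_transform g"
    by (simp add: fun_eq_iff sym_exp_sum_eq_binomial_transform g_def)
  have anti: "g (j + 2 ^ e) = - g j" for j
    using sum_choose_add_power2_parity[OF assms(4,2), of e j] assms(5)
    by (simp add: g_def minus_one_power_iff e_def)
  have ann: "shift_apply P (sym_exp_sum s k) n = 0" for n
    unfolding P_def S by (rule shift_apply_antiperiodic) (rule anti)
  \<comment> \<open>All degrees being positive, the exponent in \<open>g 0\<close> is 0. This yields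
    the nonzero value at index 0 on which the minimality argument rests.\<close>
  have "k i \<noteq> 0" if "i \<in> {1..s}" for i
    using strict_mono_on_leD[OF assms(4), of 1 i] that assms(3) by auto
  hence "(\<Sum>i=1..s. 0 choose k i) = 0"
    by (intro sum.neutral) (auto simp: binomial_eq_0)
  hence "g 0 = 1"
    by (simp only: g_def power_0)
  hence S0: "sym_exp_sum s k 0 = 1"
    by (simp add: S binomial_transform_def)
  have deg: "degree P = 2 ^ e"
    by (simp add: P_def degree_minus_one_power_plus_one)
  have monic: "lead_coeff P = 1"
    unfolding P_def by (rule lead_coeff_minus_one_power_plus_one) simp
  have coeff0: "coeff P 0 = 2"
    using e by (simp add: P_def coeff_linear_power)
  have "irreducible P"
    unfolding P_def using e(1) by (rule irreducible_minus_one_power2_plus_one)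
  hence "is_minimal_char_poly Q (sym_exp_sum s k) \<longleftrightarrow> Q = P" for Q
    using no_annihilator_of_smaller_degree[of P "sym_exp_sum s k"] ann S0 coeff0 monic
    by (intro is_minimal_char_poly_iff) auto
  moreover have "map_poly of_int P = pcompose (cyclotomic_poly (2 ^ r)) [:-1, 1:]"
    unfolding P_def e(2) by (rule map_poly_of_int_minus_one_power_plus_one)
  moreover have "P = [:2:] + (\<Sum>m=1..2 ^ e. monom ((-1) ^ m * int (2 ^ e choose m)) m)"
    unfolding P_def using e(1) by (intro poly_minus_one_power_plus_one) auto
  moreover have "nat \<lfloor>log 2 (real (k s))\<rfloor> = e"
    using assms(5) by (simp add: e_def log_nat_power)
  ultimately show ?thesis
    using deg by (simp add: sym_exp_sum_eq_binomial_transform binomial_transform_def e(2))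
qed

end
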